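(* Let $\rho_f$ be a diagonal $N\times N$ density matrix (the target state), and let $P_\gamma$ be a positive definite Hermitian $N\times N$ matrix such that for all $i\ne j$, $1\le i,j\le N$: - if $(\rho_f)_{ii}<(\rho_f)_{jj}$ then $(P_\gamma)_{ii}>(P_\gamma)_{jj}$; - if $(\rho_f)_{ii}=(\rho_f)_{jj}$ then $(P_\gamma)_{ii}\ne(P_\gamma)_{jj}$; - if $(\rho_f)_{ii}>(\rho_f)_{jj}$ then $(P_\gamma)_{ii}<(P_\gamma)_{jj}$. Let $V(\rho)=\operatorname{tr}(P_\gamma\rho)$. Then $V(\rho_f)<V(\rho_{other})$ for every $\rho_{other}\in E$ with $\rho_{other}\ne\rho_f$, where $E$ is the set of diagonal matrices whose diagonal entries are a permutation of the diagonal entries of $\rho_f$.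
   Context: A density matrix is a positive semidefinite Hermitian matrix of trace $1$. $(A)_{ij}$ denotes the $(i,j)$-th entry of $A$. The set $E$ consists of the diagonal states that are unitarily equivalent to $\rho_f$; it has at most $N!$ elements. The same matrix $P_\gamma$ is used to evaluate $V$ at $\rho_f$ and at $\rho_{other}$. *)

theory Defs
  imports "HOL-Analysis.Analysis" "HOL-Library.Complex_Order"
begin

text \<open>
  \<open>N \<times> N\<close> complex matrices are rendered as \<^typ>\<open>complex^'n^'n\<close> with \<open>N = CARD('n)\<close>.
  The order on \<^typ>\<open>complex\<close> is the one of \<^theory>\<open>HOL-Library.Complex_Order\<close>:
  \<open>x < y\<close> means \<open>Re x < Re y\<close> and \<open>Im x = Im y\<close>. Hence it is the usual order on real
  numbers, and \<open>0 \<le> z\<close> includes that \<open>z\<close> is real.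
\<close>

definition conj_transpose :: "complex^'n^'m \<Rightarrow> complex^'m^'n" where
  "conj_transpose A = (\<chi> i j. cnj (A $ j $ i))"

definition hermitian :: "complex^'n^'n \<Rightarrow> bool" where
  "hermitian A \<longleftrightarrow> conj_transpose A = A"

definition quadratic_form :: "complex^'n^'n \<Rightarrow> complex^'n \<Rightarrow> complex" where
  "quadratic_form A v = (\<Sum>i\<in>UNIV. cnj (v $ i) * (A *v v) $ i)"

definition positive_semidefinite :: "complex^'n^'n \<Rightarrow> bool" where
  "positive_semidefinite A \<longleftrightarrow> hermitian A \<and> (\<forall>v. 0 \<le> quadratic_form A v)"

definition positive_definite :: "complex^'n^'n \<Rightarrow> bool" where
  "positive_definite A \<longleftrightarrow> hermitian A \<and> (\<forall>v. v \<noteq> 0 \<longrightarrow> 0 < quadratic_form A v)"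

definition density_matrix :: "complex^'n^'n \<Rightarrow> bool" where
  "density_matrix A \<longleftrightarrow> positive_semidefinite A \<and> trace A = 1"

definition diagonal_matrix :: "complex^'n^'n \<Rightarrow> bool" where
  "diagonal_matrix A \<longleftrightarrow> (\<forall>i j. i \<noteq> j \<longrightarrow> A $ i $ j = 0)"

text \<open>The set \<open>E\<close> attached to a target state \<open>\<rho>\<^sub>f\<close>.\<close>

definition diagonal_permutations :: "complex^'n^'n \<Rightarrow> (complex^'n^'n) set" where
  "diagonal_permutations \<rho>f =
     {\<rho>. diagonal_matrix \<rho> \<and> (\<exists>p. p permutes UNIV \<and> (\<forall>i. \<rho> $ i $ i = \<rho>f $ p i $ p i))}"

text \<open>The function \<open>V(\<rho>) = tr(P\<rho>)\<close>.\<close>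

definition lyapunov :: "complex^'n^'n \<Rightarrow> complex^'n^'n \<Rightarrow> complex" where
  "lyapunov P \<rho> = trace (P ** \<rho>)"

end

theory Submission
  imports Defs
begin

text \<open>
  This is the strict rearrangement inequality. Since \<open>E\<close> is finite, some rearrangement of the
  eigenvalues of \<open>\<rho>\<^sub>f\<close> minimizes \<open>V\<close>; exchanging two entries shows that a minimizer is
  ordered oppositely to the diagonal of \<open>P\<close>. As the diagonal entries of \<open>P\<close> are distinct,
  only one rearrangement is ordered in this way, namely \<open>\<rho>\<^sub>f\<close> itself.
\<close>

text \<open>The superlevel sets of \<open>b\<close> and of \<open>b \<circ> p\<close> are both lower
  sets for the order that the injective \<open>a\<close> induces on \<open>A\<close>, so any two of
  them are nested. At a common threshold \<open>p\<close> maps one bijectively onto the other, so by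
  finiteness they coincide, and a function is determined by its superlevel sets.\<close>

lemma antitone_rearrangement_unique:
  fixes a :: "'i \<Rightarrow> 'a::linorder" and b :: "'i \<Rightarrow> 'b::linorder"
  assumes fin: "finite A" and p: "p permutes A" and inj: "inj_on a A"
    and anti_b: "\<And>i j. i \<in> A \<Longrightarrow> j \<in> A \<Longrightarrow> a i < a j \<Longrightarrow> b j \<le> b i"
    and anti_bp: "\<And>i j. i \<in> A \<Longrightarrow> j \<in> A \<Longrightarrow> a i < a j \<Longrightarrow> b (p j) \<le> b (p i)"
    and i: "i \<in> A"
  shows "b (p i) = b i"
proof -
  define S where "S = (\<lambda>f t. {k \<in> A. (t::'b) \<le> f k})"
  have S_eq: "S (b \<circ> p) t = S b t" for t
  proof -
    have finS: "finite (S f t)" for f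
      using fin by (simp add: S_def)
    have "p ` S (b \<circ> p) t = S b t"
    proof
      show "p ` S (b \<circ> p) t \<subseteq> S b t"
        using permutes_in_image[OF p] by (auto simp: S_def)
      show "S b t \<subseteq> p ` S (b \<circ> p) t"
      proof
        fix k assume k: "k \<in> S b t"
        then obtain l where "l \<in> A" "k = p l"
          using permutes_image[OF p] by (auto simp: S_def)
        with k show "k \<in> p ` S (b \<circ> p) t"
          by (auto simp: S_def)
      qed
    qed
    moreover have "inj_on p (S (b \<circ> p) t)"
      using permutes_inj[OF p] by (rule inj_on_subset) simp
    ultimately have card: "card (S (b \<circ> p) t) = card (S b t)"
      by (metis card_image)
    have "S (b \<circ> p) t \<subseteq> S b t \<or> S b t \<subseteq> S (b \<circ> p) t"
    proof (rule ccontr)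
      assume "\<not> ?thesis"
      then obtain x y where "x \<in> S b t - S (b \<circ> p) t" "y \<in> S (b \<circ> p) t - S b t"
        by blast
      then have "x \<in> A" "y \<in> A" "b (p x) < t" "t \<le> b x" "t \<le> b (p y)" "b y < t"
        by (auto simp: S_def)
      moreover from this have "a x \<noteq> a y"
        using inj by (auto simp: inj_on_def)
      ultimately show False
        using anti_b[of y x] anti_bp[of x y]
        by (cases "a x" "a y" rule: linorder_cases) auto
    qed
    then show ?thesis
      using card finS card_subset_eq by metis
  qed
  \<comment> \<open>The thresholds \<open>b (p i)\<close> and \<open>b i\<close> give the two
    opposite inequalities.\<close>
  have "i \<in> S b (b (p i))"
    using i unfolding S_eq[symmetric] by (simp add: S_def)
  moreover have "i \<in> S (b \<circ> p) (b i)"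
    using i unfolding S_eq by (simp add: S_def)
  ultimately show ?thesis
    by (simp add: S_def)
qed

lemma sum_mult_transpose_less:
  fixes a b :: "'i \<Rightarrow> 'a::linordered_idom"
  assumes fin: "finite A" and ij: "i \<in> A" "j \<in> A" and less: "a i < a j" "b i < b j"
  shows "(\<Sum>k\<in>A. a k * b (Transposition.transpose i j k)) < (\<Sum>k\<in>A. a k * b k)"
proof -
  have "i \<noteq> j"
    using less by blast
  then have split: "(\<Sum>k\<in>A. f k) = f i + f j + (\<Sum>k\<in>A - {i, j}. f k)" for f :: "'i \<Rightarrow> 'a"
    using fin ij by (subst sum.subset_diff[of "{i, j}"]) auto
  have rest: "(\<Sum>k\<in>A - {i, j}. a k * b (Transposition.transpose i j k)) = (\<Sum>k\<in>A - {i, j}. a k * b k)"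
    by (intro sum.cong) auto
  \<comment> \<open>This product is exactly the amount by which the exchange lowers the sum.\<close>
  have "0 < (a j - a i) * (b j - b i)"
    using less by simp
  then show ?thesis
    unfolding split rest by (simp add: algebra_simps)
qed

text \<open>Since \<open>b\<close> may have ties, \<open>p \<noteq> id\<close> would not force
  strictness; some value of \<open>b\<close> has to change.\<close>

theorem rearrangement_strict:
  fixes a b :: "'i \<Rightarrow> 'a::linordered_idom"
  assumes fin: "finite A" and p: "p permutes A" and inj: "inj_on a A"
    and anti: "\<And>i j. i \<in> A \<Longrightarrow> j \<in> A \<Longrightarrow> a i < a j \<Longrightarrow> b j \<le> b i"
    and ne: "i \<in> A" "b (p i) \<noteq> b i"
  shows "(\<Sum>k\<in>A. a k * b k) < (\<Sum>k\<in>A. a k * b (p k))"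
proof -
  define F where "F = (\<lambda>q. \<Sum>k\<in>A. a k * b (q k))"
  let ?Q = "{q. q permutes A}"
  have "finite ?Q" "?Q \<noteq> {}"
    using finite_permutations[OF fin] p by auto
  then obtain m where m: "m permutes A" and "\<forall>q\<in>?Q. \<not> F q < F m"
    using ex_min_if_finite[of "F ` ?Q"] by auto
  then have m_min: "F m \<le> F q" if "q permutes A" for q
    using that by (simp add: not_less)
  \<comment> \<open>Stated for every minimizer \<open>q\<close>, not only \<open>m\<close>, so that
    it also covers \<open>p\<close> in case \<open>p\<close> attains the minimum.\<close>
  have opposite: "b (q j) \<le> b (q i)"
    if q: "q permutes A" "F q = F m" and ij: "i \<in> A" "j \<in> A" "a i < a j" for q i j
  proof (rule ccontr)
    assume "\<not> ?thesis"
    then have "F (q \<circ> Transposition.transpose i j) < F q"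
      using sum_mult_transpose_less[OF fin ij, of "b \<circ> q"] by (simp add: F_def)
    moreover have "q \<circ> Transposition.transpose i j permutes A"
      using ij q by (intro permutes_compose permutes_swap_id)
    ultimately show False
      using m_min q by (metis not_less)
  qed
  have unique: "b (q k) = b k" if "q permutes A" "F q = F m" "k \<in> A" for q k
    using antitone_rearrangement_unique[of A q a b k] fin inj anti opposite that by blast
  have "F m = F id"
    unfolding F_def by (intro sum.cong) (simp_all add: unique[OF m])
  moreover have "F p \<noteq> F m"
    using unique[OF p] ne by blast
  ultimately have "F id < F p"
    using m_min[OF p] by simp
  then show ?thesis
    by (simp add: F_def)
qed

lemma hermitian_Im_diag: "hermitian A \<Longrightarrow> Im (A $ i $ i) = 0"
  unfolding hermitian_def conj_transpose_def
  by (metis (no_types, lifting) Reals_cnj_iff complex_is_Real_iff vec_lambda_beta)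

lemma lyapunov_diagonal:
  assumes "diagonal_matrix \<rho>"
  shows "lyapunov P \<rho> = (\<Sum>i\<in>UNIV. P $ i $ i * \<rho> $ i $ i)"
proof -
  have "(\<Sum>k\<in>UNIV. P $ i $ k * \<rho> $ k $ i) = P $ i $ i * \<rho> $ i $ i" for i
    using assms by (subst sum.remove[of _ i]) (auto simp: diagonal_matrix_def intro!: sum.neutral)
  then show ?thesis
    by (simp add: lyapunov_def trace_def matrix_matrix_mult_def)
qed

theorem theorem2:
  fixes \<rho>f P :: "complex^'n^'n"
  assumes "density_matrix \<rho>f"
    and "diagonal_matrix \<rho>f"
    and "positive_definite P"
    and "\<And>i j. i \<noteq> j \<Longrightarrow> \<rho>f $ i $ i < \<rho>f $ j $ j \<Longrightarrow> P $ i $ i > P $ j $ j"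
    and "\<And>i j. i \<noteq> j \<Longrightarrow> \<rho>f $ i $ i = \<rho>f $ j $ j \<Longrightarrow> P $ i $ i \<noteq> P $ j $ j"
    and "\<And>i j. i \<noteq> j \<Longrightarrow> \<rho>f $ i $ i > \<rho>f $ j $ j \<Longrightarrow> P $ i $ i < P $ j $ j"
  shows "\<forall>\<rho>other \<in> diagonal_permutations \<rho>f. \<rho>other \<noteq> \<rho>f \<longrightarrow> lyapunov P \<rho>f < lyapunov P \<rho>other"
proof (intro ballI impI)
  fix \<rho> assume "\<rho> \<in> diagonal_permutations \<rho>f" and ne: "\<rho> \<noteq> \<rho>f"
  then obtain p where diag: "diagonal_matrix \<rho>" and p: "p permutes UNIV"
    and \<rho>: "\<And>i. \<rho> $ i $ i = \<rho>f $ p i $ p i"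
    by (auto simp: diagonal_permutations_def)
  \<comment> \<open>The rearrangement inequality needs a linear order, which \<open>complex\<close>
    does not have; Hermitian matrices have real diagonals, so nothing is lost by taking real
    parts.\<close>
  define a b where "a = (\<lambda>i. Re (P $ i $ i))" and "b = (\<lambda>i. Re (\<rho>f $ i $ i))"
  have P: "P $ i $ i = of_real (a i)" for i
    using assms(3) by (simp add: a_def complex_eq_iff hermitian_Im_diag positive_definite_def)
  have \<rho>f: "\<rho>f $ i $ i = of_real (b i)" for i
    using assms(1)
    by (simp add: b_def complex_eq_iff hermitian_Im_diag density_matrix_def positive_semidefinite_def)
  have anti: "a j < a i" if "b i < b j" for i j
    using assms(4)[of i j] that by (auto simp: P \<rho>f less_complex_def)
  \<comment> \<open>Ties in \<open>b\<close> are separated by the second condition on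
    \<open>P\<close>, all other pairs by \<open>anti\<close>.\<close>
  have "a i \<noteq> a j" if "i \<noteq> j" for i j
    using assms(5)[of i j] anti[of i j] anti[of j i] that
    by (cases "b i" "b j" rule: linorder_cases) (auto simp: P \<rho>f)
  then have "inj a"
    by (auto simp: inj_def)
  obtain k l where kl: "\<rho> $ k $ l \<noteq> \<rho>f $ k $ l"
    using ne by (auto simp: vec_eq_iff)
  \<comment> \<open>Two diagonal matrices agree off the diagonal, so the differing entry is a
    diagonal one and \<open>p\<close> changes a value of \<open>b\<close>.\<close>
  then have "k = l"
    using diag assms(2) by (cases "k = l") (auto simp: diagonal_matrix_def)
  then have "b (p k) \<noteq> b k"
    using kl by (auto simp: \<rho> \<rho>f)
  with \<open>inj a\<close> have "(\<Sum>i\<in>UNIV. a i * b i) < (\<Sum>i\<in>UNIV. a i * b (p i))"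
    using anti by (intro rearrangement_strict[OF _ p]) (auto simp: not_less[symmetric] dest: order.asym)
  then show "lyapunov P \<rho>f < lyapunov P \<rho>"
    by (simp add: lyapunov_diagonal diag assms(2) P \<rho> \<rho>f less_complex_def)
qed

end
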